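(* Let $N\ge 1$ be an integer, $a>0$, $0<\alpha<1$, $\lambda\in\mathbb{C}\setminus\{0\}$ with $\lambda_1=\Re\lambda$, $\lambda_2=\Im\lambda$, and let $\gamma\in\mathbb{R}$ satisfy $\gamma>-\alpha$ and $\gamma(N\alpha-2)<2\alpha$. Let $p$ satisfy $$\max\{1,1+\gamma\}<p<1+\frac{2(\alpha+\gamma)}{N\alpha}.$$ Let $f\in L^1(\mathbb{R}^N,\mathbb{C})$, $f_1=\Re f$, $f_2=\Im f$, $r_\alpha=\cos(\pi\alpha/2)$, $s_\alpha=\sin(\pi\alpha/2)$, and suppose that $$\lambda_1\int_{\mathbb{R}^N}\bigl(r_\alpha f_1(x)-s_\alpha f_2(x)\bigr)\,dx>0\quad\text{or}\quad \lambda_2\int_{\mathbb{R}^N}\bigl(s_\alpha f_1(x)+r_\alpha f_2(x)\bigr)\,dx>0.$$ Then the initial value problem $$i^\alpha \mathcal{D}_{a|t}^\alpha u+\Delta u=\lambda\left(\ln\frac{t}{a}\right)^\gamma|u|^p,\quad t>a,\ x\in\mathbb{R}^N,\qquad u(a,x)=f(x),\quad x\in\mathbb{R}^N,$$ admits no global weak solution.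
   Context: Here $u=u(t,x)$ is complex-valued, $i^\alpha=e^{i\alpha\pi/2}$, $\Delta$ is the Laplacian in $x$, and $\mathcal{D}_{a|t}^\alpha$ is the left/forward Hadamard-Caputo fractional derivative of order $\alpha\in(0,1)$ in $t$, $(\mathcal{D}_{a|t}^\alpha u)(t,x)=\frac{1}{\Gamma(1-\alpha)}\int_a^t\left(\ln\frac{t}{s}\right)^{-\alpha}\frac{\partial u}{\partial s}(s,x)\,ds$. Write $u_1=\Re u$, $u_2=\Im u$. For $T>a$ let $Q_T=[a,T]\times\mathbb{R}^N$ and let $\Phi_T$ be the set of real-valued functions $\varphi\in C^{1,2}_{t,x}(Q_T,\mathbb{R})$ (once continuously differentiable in $t$, twice in $x$) with $\mathrm{supp}_x\,\varphi\subset\subset\mathbb{R}^N$ (compact support in $x$). For $\sigma>0$, the right-sided Hadamard fractional integral in $t$ is $(J_{T|t}^\sigma v)(t,x)=\frac{1}{\Gamma(\sigma)}\int_t^T\left(\ln\frac{s}{t}\right)^{\sigma-1}v(s,x)\frac{1}{s}\,ds$. The notation $J_{T|t}^{1-\alpha}\,t\varphi$ means $J_{T|t}^{1-\alpha}$ applied to the function $(t,x)\mapsto t\varphi(t,x)$, i.e. $(J_{T|t}^{1-\alpha}\,t\varphi)(t,x)=\frac{1}{\Gamma(1-\alpha)}\int_t^T\left(\ln\frac{s}{t}\right)^{-\alpha}\varphi(s,x)\,ds$. Definition. $u$ is a global weak solution of the problem if: (i) $u\in L^1_{loc}([a,\infty)\times\mathbb{R}^N,\mathbb{C})$ and $\left(\ln\frac{t}{a}\right)^\gamma|u|^p\in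 L^1_{loc}([a,\infty)\times\mathbb{R}^N,\mathbb{R})$; (ii) for all $T>a$ and all $\varphi\in\Phi_T$, $$\lambda_1\int_{Q_T}\left(\ln\frac{t}{a}\right)^\gamma|u|^p\varphi\,dx\,dt+\int_{\mathbb{R}^N}(r_\alpha f_1(x)-s_\alpha f_2(x))(J_{T|t}^{1-\alpha}\,t\varphi)(a,x)\,dx=\int_{Q_T}u_1\Delta\varphi\,dx\,dt-\int_{Q_T}(r_\alpha u_1-s_\alpha u_2)\frac{\partial (J_{T|t}^{1-\alpha}\,t\varphi)}{\partial t}\,dx\,dt$$ and $$\lambda_2\int_{Q_T}\left(\ln\frac{t}{a}\right)^\gamma|u|^p\varphi\,dx\,dt+\int_{\mathbb{R}^N}(s_\alpha f_1(x)+r_\alpha f_2(x))(J_{T|t}^{1-\alpha}\,t\varphi)(a,x)\,dx=\int_{Q_T}u_2\Delta\varphi\,dx\,dt-\int_{Q_T}(s_\alpha u_1+r_\alpha u_2)\frac{\partial (J_{T|t}^{1-\alpha}\,t\varphi)}{\partial t}\,dx\,dt.$$ *)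

theory Defs
  imports "HOL-Analysis.Analysis"
begin

definition L1_loc_on ::
  "'a::euclidean_space set \<Rightarrow> ('a \<Rightarrow> 'b::{banach,second_countable_topology}) \<Rightarrow> bool" where
  "L1_loc_on S g \<longleftrightarrow> (\<forall>K. compact K \<and> K \<subseteq> S \<longrightarrow> set_integrable lebesgue K g)"

definition Q :: "real \<Rightarrow> real \<Rightarrow> (real \<times> (real ^ 'n)) set" where
  "Q a T = {a..T} \<times> UNIV"

definition partial :: "'n::finite \<Rightarrow> (real ^ 'n \<Rightarrow> real) \<Rightarrow> real ^ 'n \<Rightarrow> real" where
  "partial i g x = deriv (\<lambda>h. g (x + h *\<^sub>R axis i 1)) 0"

definition laplacian :: "(real ^ 'n::finite \<Rightarrow> real) \<Rightarrow> real ^ 'n \<Rightarrow> real" where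
  "laplacian g x = (\<Sum>i\<in>UNIV. partial i (partial i g) x)"

text \<open>
  The class of functions that are once continuously differentiable in time and twice in space on
  the closed slab \<^term>\<open>Q a T\<close>: all the derivatives exist and are jointly continuous on the slab.
  Time derivatives at the end points are one-sided; values outside the slab play no role.
\<close>

definition C12_on_slab :: "real \<Rightarrow> real \<Rightarrow> (real \<times> (real ^ 'n::finite) \<Rightarrow> real) \<Rightarrow> bool" where
  "C12_on_slab a T \<phi> \<longleftrightarrow>
     (\<exists>Dt Dx Dxx.
        continuous_on (Q a T) \<phi> \<and> continuous_on (Q a T) Dt \<and>
        (\<forall>i. continuous_on (Q a T) (Dx i)) \<and> (\<forall>i j. continuous_on (Q a T) (Dxx i j)) \<and>
        (\<forall>t\<in>{a..T}. \<forall>x.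
           ((\<lambda>s. \<phi> (s, x)) has_real_derivative Dt (t, x)) (at t within {a..T}) \<and>
           (\<forall>i. ((\<lambda>h. \<phi> (t, x + h *\<^sub>R axis i 1)) has_real_derivative Dx i (t, x)) (at 0)) \<and>
           (\<forall>i j. ((\<lambda>h. Dx i (t, x + h *\<^sub>R axis j 1)) has_real_derivative Dxx i j (t, x)) (at 0))))"

definition test_functions :: "real \<Rightarrow> real \<Rightarrow> (real \<times> (real ^ 'n::finite) \<Rightarrow> real) set" where
  "test_functions a T =
     {\<phi>. C12_on_slab a T \<phi> \<and> compact (closure {x. \<exists>t\<in>{a..T}. \<phi> (t, x) \<noteq> 0})}"

text \<open>Right-sided Hadamard fractional integral of order \<open>\<sigma>\<close> in the time variable.\<close>

definition hadamard_J ::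
  "real \<Rightarrow> real \<Rightarrow> (real \<times> 'a \<Rightarrow> real) \<Rightarrow> real \<times> 'a \<Rightarrow> real" where
  "hadamard_J T \<sigma> v = (\<lambda>(t, x).
     1 / Gamma \<sigma> * (LINT s:{t..T}|lebesgue. ln (s / t) powr (\<sigma> - 1) * v (s, x) * (1 / s)))"

text \<open>
  Global weak solutions \<open>u\<close> of
  \<open>i\<^sup>\<alpha> D\<^sup>\<alpha> u + \<Delta> u = \<mu> (ln (t/a))\<^sup>\<gamma> |u|\<^sup>p\<close>, \<open>u(a, \<cdot>) = f\<close>,
  where \<open>D\<^sup>\<alpha>\<close> is the left Hadamard-Caputo derivative in time based at \<open>a\<close> and
  \<open>i\<^sup>\<alpha> = exp (i \<pi> \<alpha> / 2) = r + i s\<close>. Only the values of \<open>u\<close> for \<open>t \<ge> a\<close> play a role.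
  The function \<open>Jt\<phi>\<close> is differentiable in time for \<open>a < t < T\<close>, so \<^const>\<open>deriv\<close> is the genuine
  derivative up to a null set. It may be unbounded near \<open>t = T\<close>, so the last integral need not
  exist for every \<open>u\<close> and every \<open>\<phi>\<close>; a solution that in addition has all these integrals
  convergent is in particular a solution in the sense below.
\<close>

definition global_weak_solution ::
  "real \<Rightarrow> real \<Rightarrow> complex \<Rightarrow> real \<Rightarrow> real \<Rightarrow> (real ^ 'n::finite \<Rightarrow> complex)
     \<Rightarrow> (real \<times> (real ^ 'n) \<Rightarrow> complex) \<Rightarrow> bool" where
  "global_weak_solution a \<alpha> \<mu> \<gamma> p f u \<longleftrightarrow>
     L1_loc_on ({a..} \<times> UNIV) u \<and>
     L1_loc_on ({a..} \<times> UNIV) (\<lambda>(t, x). ln (t / a) powr \<gamma> * cmod (u (t, x)) powr p) \<and>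
     (\<forall>T>a. \<forall>\<phi>\<in>test_functions a T.
        let r = cos (pi * \<alpha> / 2);
            s = sin (pi * \<alpha> / 2);
            Jt\<phi> = hadamard_J T (1 - \<alpha>) (\<lambda>(t, x). t * \<phi> (t, x))
        in
        Re \<mu> * (LINT (t, x):Q a T|lebesgue. ln (t / a) powr \<gamma> * cmod (u (t, x)) powr p * \<phi> (t, x))
        + (LINT x|lebesgue. (r * Re (f x) - s * Im (f x)) * Jt\<phi> (a, x))
        = (LINT (t, x):Q a T|lebesgue. Re (u (t, x)) * laplacian (\<lambda>y. \<phi> (t, y)) x)
        - (LINT (t, x):Q a T|lebesgue.
             (r * Re (u (t, x)) - s * Im (u (t, x))) * deriv (\<lambda>\<tau>. Jt\<phi> (\<tau>, x)) t)
        \<and>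
        Im \<mu> * (LINT (t, x):Q a T|lebesgue. ln (t / a) powr \<gamma> * cmod (u (t, x)) powr p * \<phi> (t, x))
        + (LINT x|lebesgue. (s * Re (f x) + r * Im (f x)) * Jt\<phi> (a, x))
        = (LINT (t, x):Q a T|lebesgue. Im (u (t, x)) * laplacian (\<lambda>y. \<phi> (t, y)) x)
        - (LINT (t, x):Q a T|lebesgue.
             (s * Re (u (t, x)) + r * Im (u (t, x))) * deriv (\<lambda>\<tau>. Jt\<phi> (\<tau>, x)) t))"

end

theory Submission
  imports Defs
begin

text \<open>
  The equation is tested with \<open>\<phi>(t, x) = (1/t) (ln (T/t) / L)\<^sup>l \<psi>(x/R)\<^sup>m\<close>, where \<open>L = ln (T/a) = R powr (2/\<alpha>)\<close>
  and \<open>\<psi>(x) = max 0 (1 - |x|\<^sup>2)\<close>. In the variable \<open>ln t\<close> the Hadamard integral is a Beta integral, so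
  \<open>J(t\<phi>)\<close> is an explicit power of \<open>ln (T/t)\<close>, and both \<open>\<Delta>\<phi>\<close> and the time derivative of \<open>J(t\<phi>)\<close> are of order \<open>R\<^sup>-\<^sup>2/t\<close>.
  Young's inequality absorbs \<open>|u|\<close> on the right into the nonlinear term and leaves
  \<open>(1/\<lambda>) \<integral> g \<psi>(x/R)\<^sup>m dx \<le> K R powr (N - 2 (1 + \<gamma>/\<alpha>) / (p - 1))\<close> for the real (or imaginary) part \<open>\<lambda>\<close> of the
  coefficient and the corresponding combination \<open>g\<close> of the data. The exponent is negative in the subcritical
  range, so \<open>R \<rightarrow> \<infinity>\<close> contradicts the sign condition.
\<close>

section \<open>Young's inequality and a comparison of integrals\<close>

text \<open>The product is at most whichever term dominates: if
  \<open>A \<le> B * x powr (p-1)\<close>, the first term suffices; otherwise \<open>x\<close> is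
  below \<open>(A/B) powr (1/(p-1))\<close>, which gives the second. The exponent
  \<open>1 + 1/(p-1)\<close> is the conjugate exponent of \<open>p\<close>.\<close>

lemma young_split:
  fixes x A B p :: real
  assumes "x \<ge> 0" "A \<ge> 0" "B > 0" "p > 1"
  shows "x * A \<le> B * x powr p + A powr (1 + 1/(p-1)) * B powr (- (1/(p-1)))"
proof (cases "A \<le> B * x powr (p-1)")
  case True
  have "x * A \<le> x * (B * x powr (p-1))" using True assms by (intro mult_left_mono)
  also have "\<dots> = B * x powr p" 
    using assms powr_add[of x 1 "p-1"] by (cases "x = 0") auto
  finally show ?thesis using assms by (smt (verit) mult_nonneg_nonneg powr_ge_zero)
next
  case False
  have *: "A > 0" using False assms by (smt (verit) mult_nonneg_nonneg powr_ge_zero)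
  have "x powr (p-1) \<le> A / B" using False assms by (simp add: field_simps)
  then have "(x powr (p-1)) powr (1/(p-1)) \<le> (A/B) powr (1/(p-1))"
    using assms by (intro powr_mono2) auto
  then have "x \<le> (A/B) powr (1/(p-1))" using assms by (simp add: powr_powr)
  then have "x * A \<le> (A/B) powr (1/(p-1)) * A" using assms by (intro mult_right_mono)
  also have "\<dots> = A powr (1 + 1/(p-1)) * B powr (- (1/(p-1)))"
    using * assms by (simp only: powr_add) (simp add: powr_divide powr_minus field_simps)
  finally show ?thesis using assms by (smt (verit) mult_nonneg_nonneg powr_ge_zero)
qed

text \<open>A non-integrable \<open>F\<close> has integral 0 by convention, while \<open>H\<close>
  is nonnegative almost everywhere, so the bound survives divergence. This matters because the
  integrals on the right of the weak formulation are not known to converge.\<close>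

lemma abs_integral_le_AE:
  fixes F H :: "'a \<Rightarrow> real"
  assumes "AE z in M. \<bar>F z\<bar> \<le> H z" "integrable M H"
  shows "\<bar>integral\<^sup>L M F\<bar> \<le> integral\<^sup>L M H"
proof (cases "integrable M F")
  case True
  then have "\<bar>integral\<^sup>L M F\<bar> \<le> (\<integral>z. \<bar>F z\<bar> \<partial>M)" by (intro integral_abs_bound)
  also have "\<dots> \<le> integral\<^sup>L M H" using True assms by (intro integral_mono_AE) auto
  finally show ?thesis .
next
  case False
  have "AE z in M. 0 \<le> H z" using assms(1) by eventually_elim auto
  then show ?thesis using False by (simp add: not_integrable_integral_eq integral_nonneg_AE)
qed

section \<open>Logarithmic integrals in time and integration over the slab\<close>

text \<open>Substituting \<open>y = ln (s/t) / m\<close> with \<open>m = ln (T/t)\<close> turns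
  \<open>ds/s\<close> into \<open>m dy\<close> and \<open>ln (T/s)\<close> into
  \<open>m * (1 - y)\<close>, which leaves Euler's Beta integral times a power of
  \<open>m\<close>.\<close>

lemma log_beta_integral:
  fixes t T \<sigma> :: real
  assumes "0 < t" "t < T" "\<sigma> > 0" "l > 0"
  shows "(LINT s:{t..T}|lebesgue. ln (s / t) powr (\<sigma> - 1) * ln (T / s) ^ l * (1 / s))
     = Beta \<sigma> (real l + 1) * ln (T / t) powr (real l + \<sigma>)"
proof -
  define m where "m = ln (T / t)"
  have m: "m > 0" using assms by (simp add: m_def)
  define g where "g s = ln (s / t) / m" for s
  define F :: "real \<Rightarrow> real" where "F y = y powr (\<sigma> - 1) * (1 - y) powr (real l + 1 - 1)" for y
  have hF: "(F has_integral Beta \<sigma> (real l + 1)) {0..1}"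
    unfolding F_def using assms by (intro has_integral_Beta_real) auto
  have img: "g ` {t..T} = {0..1}"
  proof
    show "g ` {t..T} \<subseteq> {0..1}" using assms m by (auto simp: g_def m_def divide_simps)
    show "{0..1} \<subseteq> g ` {t..T}"
    proof
      fix y :: real assume y: "y \<in> {0..1}"
      have "g (t * exp (m * y)) = y" using assms m by (simp add: g_def)
      moreover have "t * exp (m * y) \<in> {t..T}"
      proof -
        have "m * y \<le> ln (T / t)" using y m by (simp add: mult_left_le flip: m_def)
        then have "exp (m * y) \<le> T / t" using assms by (simp add: ln_ge_iff)
        then show ?thesis using assms y m by (auto simp: field_simps)
      qed
      ultimately show "y \<in> g ` {t..T}" by force
    qed
  qed
  have inj: "inj_on g {t..T}" using assms m by (auto simp: inj_on_def g_def)
  have der: "(g has_field_derivative 1 / (m * s)) (at s within {t..T})" if "s \<in> {t..T}" for s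
    unfolding g_def using that assms m by (auto intro!: derivative_eq_intros simp: field_simps)
  have "F absolutely_integrable_on g ` {t..T} \<and> integral (g ` {t..T}) F = Beta \<sigma> (real l + 1)"
    unfolding img using hF
    by (auto intro!: nonnegative_absolutely_integrable_1 simp: F_def has_integral_integrable_integral)
  \<comment> \<open>Only \<open>F\<close> is singular (at 0, when \<open>\<sigma> < 1\<close>);
    \<open>g\<close> is smooth up to the end points, so the change of variables for absolutely
    integrable functions applies on the closed interval.\<close>
  then have *: "(\<lambda>s. \<bar>1 / (m * s)\<bar> * F (g s)) absolutely_integrable_on {t..T}"
     "integral {t..T} (\<lambda>s. \<bar>1 / (m * s)\<bar> * F (g s)) = Beta \<sigma> (real l + 1)"
    using has_absolute_integral_change_of_variables_1'[OF _ der inj, of F "Beta \<sigma> (real l + 1)"] by auto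
  have eq: "ln (s / t) powr (\<sigma> - 1) * ln (T / s) ^ l * (1 / s) 
     = m powr (real l + \<sigma>) * (\<bar>1 / (m * s)\<bar> * F (g s))" if "s \<in> {t..T}" for s
  proof -
    have s: "s > 0" "ln (s/t) \<ge> 0" using that assms by auto
    have 1: "ln (T / s) = m * (1 - g s)" using s assms m by (simp add: g_def m_def ln_div field_simps)
    have 2: "(1 - g s) \<ge> 0" using img that by force
    have 3: "ln (s / t) = m * g s" using m by (simp add: g_def)
    have 4: "g s \<ge> 0" using s m by (simp add: g_def)
    \<comment> \<open>At \<open>s = T\<close> the base is 0. There \<open>0 powr 0 = 0\<close> but
      \<open>0 ^ 0 = 1\<close>, so the positivity of \<open>l\<close> is what makes both powers
      agree.\<close>
    have 5: "(1 - g s) powr (real l) = (1 - g s) ^ l"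
      using 2 assms(4) by (simp add: powr_realpow')
    have 6: "m powr (real l + \<sigma>) = m ^ l * (m powr (\<sigma> - 1) * m)"
      using m by (simp add: powr_add powr_diff powr_realpow)
    have 7: "(m * g s) powr (\<sigma> - 1) = m powr (\<sigma> - 1) * g s powr (\<sigma> - 1)"
      using m 4 by (simp add: powr_mult)
    show ?thesis unfolding 1 3 F_def 6 7 power_mult_distrib using m s 5 by simp
  qed
  have "(LINT s:{t..T}|lebesgue. ln (s / t) powr (\<sigma> - 1) * ln (T / s) ^ l * (1 / s))
     = (LINT s:{t..T}|lebesgue. m powr (real l + \<sigma>) * (\<bar>1 / (m * s)\<bar> * F (g s)))"
    by (rule set_lebesgue_integral_cong) (use eq in auto)
  also have "\<dots> = m powr (real l + \<sigma>) * Beta \<sigma> (real l + 1)"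
    using set_lebesgue_integral_eq_integral(2)[OF *(1)] *(2) by (simp only: set_integral_mult_right)
  finally show ?thesis by (simp add: m_def)
qed

text \<open>Since \<open>d + 1 > 0\<close>, the antiderivative
  \<open>ln (t/a) powr (d+1) / (d+1)\<close> is continuous up to \<open>t = a\<close> and vanishes
  there. The fundamental theorem then needs the derivative only in the interior, although the
  integrand may blow up at \<open>a\<close>.\<close>

lemma log_power_integral:
  fixes a T d :: real
  assumes "0 < a" "a < T" "d > -1"
  shows "(\<lambda>t. 1 / t * ln (t / a) powr d) absolutely_integrable_on {a..T}"
    and "(LINT t:{a..T}|lebesgue. 1 / t * ln (t / a) powr d) = ln (T / a) powr (d + 1) / (d + 1)"
proof -
  have "((\<lambda>t. 1 / t * ln (t / a) powr d) has_integral 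
      (ln (T / a) powr (d + 1) / (d + 1) - ln (a / a) powr (d + 1) / (d + 1))) {a..T}"
  proof (rule fundamental_theorem_of_calculus_interior)
    show "continuous_on {a..T} (\<lambda>t. ln (t / a) powr (d + 1) / (d + 1))"
      using assms by (intro continuous_intros continuous_on_powr') auto
    fix t assume t: "t \<in> {a<..<T}"
    then have "((\<lambda>t. ln (t / a) powr (d + 1) / (d + 1)) has_real_derivative 1 / t * ln (t / a) powr d) (at t)"
    proof -
      have D: "((\<lambda>t. ln (t / a)) has_real_derivative 1 / t) (at t)"
        using t assms by (auto intro!: derivative_eq_intros simp: field_simps)
      show ?thesis
        using DERIV_cdivide[OF DERIV_fun_powr[OF D, of "d + 1"], of "d + 1"] t assms by simp
    qed
    then show "((\<lambda>t. ln (t / a) powr (d + 1) / (d + 1)) has_vector_derivative 1 / t * ln (t / a) powr d) (at t)"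
      by (simp add: has_real_derivative_iff_has_vector_derivative)
  qed (use assms in auto)
  then have *: "((\<lambda>t. 1 / t * ln (t / a) powr d) has_integral (ln (T / a) powr (d + 1) / (d + 1))) {a..T}"
    using assms by simp
  then show 1: "(\<lambda>t. 1 / t * ln (t / a) powr d) absolutely_integrable_on {a..T}"
    using assms by (intro nonnegative_absolutely_integrable_1) auto
  show "(LINT t:{a..T}|lebesgue. 1 / t * ln (t / a) powr d) = ln (T / a) powr (d + 1) / (d + 1)"
    using set_lebesgue_integral_eq_integral(2)[OF 1] * by (simp add: integral_unique)
qed

text \<open>Fubini is applied to \<open>lborel\<close>, whose product is again
  \<open>lborel\<close>; for Borel functions both claims then pass to the completion
  \<open>lebesgue\<close>.\<close>

lemma product_integral_lebesgue:
  fixes h :: "'a::euclidean_space \<Rightarrow> real" and k :: "'b::euclidean_space \<Rightarrow> real"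
  assumes h: "integrable lborel h" and k: "integrable lborel k"
  shows "integrable lebesgue (\<lambda>(t, x). h t * k x)"
    and "(LINT (t, x)|lebesgue. h t * k x) = (LINT t|lebesgue. h t) * (LINT x|lebesgue. k x)"
proof -
  have [measurable]: "h \<in> borel_measurable borel" "k \<in> borel_measurable borel"
    using h k by (auto dest: borel_measurable_integrable)
  have 1: "integrable (lborel \<Otimes>\<^sub>M lborel) (\<lambda>(t, x). h t * k x)"
    using h k by (intro lborel_pair.Fubini_integrable) (auto simp: abs_mult)
  have [measurable]: "(\<lambda>(t, x). h t * k x) \<in> borel_measurable (borel :: ('a \<times> 'b) measure)"
    unfolding borel_prod[symmetric] by measurable
  show "integrable lebesgue (\<lambda>(t, x). h t * k x)"
    using 1 unfolding lborel_prod by (simp add: integrable_completion)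
  show "(LINT (t, x)|lebesgue. h t * k x) = (LINT t|lebesgue. h t) * (LINT x|lebesgue. k x)"
    using lborel_pair.integral_fst'[OF 1] unfolding lborel_prod by (simp add: integral_completion)
qed

text \<open>Evaluates the remainder that Young's inequality leaves, where
  \<open>d = - \<gamma>/(p-1)\<close>: a time integral times the volume of a ball.\<close>

lemma slab_integral:
  fixes a T d R :: real
  assumes "0 < a" "a < T" "d > -1"
  shows "set_integrable lebesgue (Q a T :: (real \<times> (real^'n::finite)) set) (\<lambda>(t, x). 1 / t * ln (t / a) powr d * indicator (cball 0 R) x)"
    and "(LINT (t, x):(Q a T :: (real \<times> (real^'n)) set)|lebesgue. 1 / t * ln (t / a) powr d * indicator (cball 0 R) x)
       = ln (T / a) powr (d + 1) / (d + 1) * measure lebesgue (cball (0 :: real^'n) R)"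
proof -
  let ?h = "\<lambda>t. indicator {a..T} t * (1 / t * ln (t / a) powr d) :: real"
  let ?k = "indicator (cball 0 R) :: real^'n \<Rightarrow> real"
  have m: "?h \<in> borel_measurable borel" "?k \<in> borel_measurable borel"
    by (auto intro!: borel_measurable_indicator)
  have "integrable lebesgue ?h" using log_power_integral(1)[OF assms] by (simp add: set_integrable_def)
  then have h: "integrable lborel ?h" using m by (simp add: integrable_completion)
  have k: "integrable lborel ?k" using emeasure_lborel_cball_finite[of 0 R] by (intro integrable_real_indicator) auto
  have eq: "(\<lambda>z. indicator (Q a T) z *\<^sub>R (case z of (t, x) \<Rightarrow> 1 / t * ln (t / a) powr d * ?k x)) = (\<lambda>(t, x). ?h t * ?k x)"
    by (auto simp: Q_def indicator_def)
  show "set_integrable lebesgue (Q a T :: (real \<times> (real^'n::finite)) set) (\<lambda>(t, x). 1 / t * ln (t / a) powr d * ?k x)"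
    unfolding set_integrable_def eq using product_integral_lebesgue(1)[OF h k] .
  show "(LINT (t, x):(Q a T :: (real \<times> (real^'n)) set)|lebesgue. 1 / t * ln (t / a) powr d * ?k x)
       = ln (T / a) powr (d + 1) / (d + 1) * measure lebesgue (cball (0 :: real^'n) R)"
    using product_integral_lebesgue(2)[OF h k] log_power_integral(2)[OF assms]
    unfolding set_lebesgue_integral_def eq by (simp add: mult.assoc)
qed

section \<open>The spatial cutoff and its Laplacian\<close>

text \<open>The cutoff \<open>\<psi>(x/R)\<close> to the power \<open>k\<close>. Each derivative
  lowers the power by one and brings out a factor linear in \<open>x\<close>, so derivatives stay
  explicit and are controlled by lower powers of the same cutoff.\<close>

definition bump :: "real \<Rightarrow> nat \<Rightarrow> real ^ 'n::finite \<Rightarrow> real" where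
  "bump R k x = max 0 (1 - (x \<bullet> x) / R\<^sup>2) ^ k"

text \<open>Away from 0 the function is locally a power or zero. At 0 the difference quotient is at
  most \<open>\<bar>h\<bar> ^ (k - 1)\<close>, which tends to 0 because
  \<open>k \<ge> 2\<close>.\<close>

lemma has_real_derivative_pos_part_power:
  fixes y :: real
  assumes "k \<ge> 2"
  shows "((\<lambda>y. max 0 y ^ k) has_real_derivative real k * max 0 y ^ (k - 1)) (at y)"
proof -
  consider "y > 0" | "y < 0" | "y = 0" by linarith
  then show ?thesis
  proof cases
    case 1
    have "((\<lambda>y. y ^ k) has_real_derivative real k * max 0 y ^ (k - 1)) (at y)"
      using 1 by (auto intro!: derivative_eq_intros)
    then show ?thesis
      by (rule has_field_derivative_transform_within_open[of _ _ _ "{0<..}"]) (use 1 in auto)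
  next
    case 2
    have "((\<lambda>y. 0) has_real_derivative real k * max 0 y ^ (k - 1)) (at y)"
      using 2 assms by (auto intro!: derivative_eq_intros)
    then show ?thesis
      by (rule has_field_derivative_transform_within_open[of _ _ _ "{..<0}"]) (use 2 assms in auto)
  next
    case 3
    have "(\<lambda>h. \<bar>h\<bar> ^ (k - 1)) \<midarrow>0\<rightarrow> \<bar>0::real\<bar> ^ (k - 1)"
      by (intro tendsto_intros)
    then have "(\<lambda>h::real. \<bar>h\<bar> ^ (k - 1)) \<midarrow>0\<rightarrow> 0"
      using assms by (simp only: abs_zero power_0_left) (simp split: if_splits)
    moreover have "\<forall>\<^sub>F h::real in at 0. norm (max 0 h ^ k / h) \<le> \<bar>h\<bar> ^ (k - 1)"
    proof (rule always_eventually, intro allI)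
      fix h :: real
      show "norm (max 0 h ^ k / h) \<le> \<bar>h\<bar> ^ (k - 1)"
        using assms power_minus_mult[of k h] by (cases "h > 0") (auto simp: max_def field_simps power_0_left)
    qed
    ultimately have "(\<lambda>h::real. max 0 h ^ k / h) \<midarrow>0\<rightarrow> 0"
      by (rule Lim_null_comparison[rotated])
    then show ?thesis using 3 assms by (simp add: DERIV_def power_0_left)
  qed
qed

lemma bump_nonneg: "bump R k x \<ge> 0"
  by (simp add: bump_def)

lemma bump_le_1: "bump R k x \<le> 1"
  unfolding bump_def by (intro power_le_one) auto

lemma bump_eq_power: "bump R k x = bump R 1 x ^ k"
  by (simp add: bump_def)

lemma bump_eq_0: "R > 0 \<Longrightarrow> k > 0 \<Longrightarrow> x \<notin> cball 0 R \<Longrightarrow> bump R k x = 0"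
  by (auto simp: bump_def max_def dot_square_norm field_simps power_mono_iff)

lemma continuous_on_bump [continuous_intros]: "continuous_on S (bump R k)"
  unfolding bump_def by (cases "R = 0") (auto intro!: continuous_intros)

lemma bump_borel_measurable [measurable]: "bump R k \<in> borel_measurable borel"
  by (intro borel_measurable_continuous_onI continuous_intros)

lemma bump_tendsto_1: "((\<lambda>R. bump R k x) \<longlongrightarrow> 1) at_top"
proof -
  have "((\<lambda>R. (x \<bullet> x) / R\<^sup>2) \<longlongrightarrow> 0) at_top"
    by (intro real_tendsto_divide_at_top[OF tendsto_const] filterlim_pow_at_top filterlim_ident) auto
  then have "((\<lambda>R. max 0 (1 - (x \<bullet> x) / R\<^sup>2) ^ k) \<longlongrightarrow> max 0 (1 - 0) ^ k) at_top"
    by (intro tendsto_intros)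
  then show ?thesis by (simp add: bump_def)
qed

lemma bump_has_derivative:
  fixes x :: "real ^ 'n"
  assumes "k \<ge> 2"
  shows "((\<lambda>h. bump R k (x + h *\<^sub>R axis i 1)) has_real_derivative
     - (2 * real k / R\<^sup>2) * (x $ i * bump R (k - 1) x)) (at 0)"
proof -
  have eq: "(x + h *\<^sub>R axis i 1) \<bullet> (x + h *\<^sub>R axis i 1) = x \<bullet> x + 2 * h * x $ i + h\<^sup>2" for h
    by (simp add: inner_add_left inner_add_right inner_axis inner_axis' power2_eq_square)
      (simp add: algebra_simps)
  have "((\<lambda>h. 1 - (x \<bullet> x + 2 * h * x $ i + h\<^sup>2) / R\<^sup>2) has_real_derivative - (2 * x $ i) / R\<^sup>2) (at 0)"
    by (cases "R = 0") (auto intro!: derivative_eq_intros simp: field_simps)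
  from DERIV_chain2[OF has_real_derivative_pos_part_power[OF assms] this]
  show ?thesis unfolding bump_def eq by (simp add: mult_ac)
qed

lemma bump_has_derivative2:
  fixes x :: "real ^ 'n"
  assumes "k \<ge> 3"
  shows "((\<lambda>h. - (2 * real k / R\<^sup>2) * ((x + h *\<^sub>R axis j 1) $ i * bump R (k - 1) (x + h *\<^sub>R axis j 1)))
     has_real_derivative - (2 * real k / R\<^sup>2) * (axis j 1 $ i * bump R (k - 1) x
        - 2 * (real k - 1) / R\<^sup>2 * (x $ i * x $ j * bump R (k - 2) x))) (at 0)"
proof -
  have k: "k - 1 - 1 = k - 2" "real (k - 1) = real k - 1" "k - 1 \<ge> 2" using assms by auto
  have "((\<lambda>h. (x + h *\<^sub>R axis j 1) $ i) has_real_derivative axis j 1 $ i) (at 0)"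
    by (auto intro!: derivative_eq_intros)
  from DERIV_cmult[OF DERIV_mult[OF this bump_has_derivative[OF k(3), of R x j]], of "- (2 * real k / R\<^sup>2)"]
  show ?thesis unfolding k by (simp add: algebra_simps)
qed

lemma laplacian_bump:
  fixes x :: "real ^ 'n"
  assumes "k \<ge> 3"
  shows "laplacian (\<lambda>y. b * bump R k y) x = b * (- (2 * real k / R\<^sup>2) *
     (real CARD('n) * bump R (k - 1) x - 2 * (real k - 1) / R\<^sup>2 * ((x \<bullet> x) * bump R (k - 2) x)))"
proof -
  have 1: "partial i (\<lambda>y. b * bump R k y) = (\<lambda>y. b * (- (2 * real k / R\<^sup>2) * (y $ i * bump R (k - 1) y)))" for i
    unfolding partial_def using assms
    by (intro ext DERIV_imp_deriv DERIV_cmult bump_has_derivative) auto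
  have 2: "partial i (partial i (\<lambda>y. b * bump R k y)) x = b * (- (2 * real k / R\<^sup>2) * (axis i 1 $ i * bump R (k - 1) x
        - 2 * (real k - 1) / R\<^sup>2 * (x $ i * x $ i * bump R (k - 2) x)))" for i
    unfolding 1 unfolding partial_def using assms
    by (intro DERIV_imp_deriv DERIV_cmult bump_has_derivative2) auto
  have 3: "(\<Sum>i\<in>UNIV. b * (c * (axis i 1 $ i * A - e * (x $ i * x $ i * B)))) =
      b * (c * (real CARD('n) * A - e * ((x \<bullet> x) * B)))" for c e A B :: real
    by (simp add: sum_subtractf sum_distrib_left[symmetric] inner_vec_def sum_distrib_right[symmetric])
  show ?thesis unfolding laplacian_def 2 3 ..
qed

text \<open>On the support \<open>x \<bullet> x \<le> R^2\<close>, so the factor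
  \<open>x \<bullet> x\<close> of the second-order term costs one of its two factors
  \<open>1/R^2\<close>. Both terms are thus of order \<open>1/R^2\<close>, and the power
  \<open>k - 2\<close> of the cutoff dominates them.\<close>

lemma laplacian_bump_bound:
  fixes x :: "real ^ 'n"
  assumes "k \<ge> 3" "R > 0"
  shows "\<bar>laplacian (\<lambda>y. b * bump R k y) x\<bar>
     \<le> 2 * real k * (real CARD('n) + 2 * real k) * (\<bar>b\<bar> / R\<^sup>2 * bump R (k - 2) x)"
proof -
  have 1: "bump R (k - 1) x \<le> bump R (k - 2) x"
    unfolding bump_def by (intro power_decreasing) (use assms in auto)
  have 2: "0 \<le> (x \<bullet> x) / R\<^sup>2 * bump R (k - 2) x \<and> (x \<bullet> x) / R\<^sup>2 * bump R (k - 2) x \<le> bump R (k - 2) x"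
  proof (cases "(x \<bullet> x) / R\<^sup>2 \<le> 1")
    case True then show ?thesis using bump_nonneg[of R "k-2" x] by (intro conjI mult_left_le_one_le mult_nonneg_nonneg) auto
  next
    case False
    then have "bump R (k - 2) x = 0" using assms by (simp add: bump_def)
    then show ?thesis by simp
  qed
  have "\<bar>real CARD('n) * bump R (k - 1) x - 2 * (real k - 1) * ((x \<bullet> x) / R\<^sup>2 * bump R (k - 2) x)\<bar>
    \<le> real CARD('n) * bump R (k - 1) x + 2 * (real k - 1) * ((x \<bullet> x) / R\<^sup>2 * bump R (k - 2) x)"
    using 2 bump_nonneg[of R "k-1" x] assms
    by (intro order.trans[OF abs_triangle_ineq4]) (auto simp: abs_mult)
  also have "\<dots> \<le> real CARD('n) * bump R (k - 2) x + 2 * real k * bump R (k - 2) x"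
    using 1 2 assms bump_nonneg[of R _ x] by (intro add_mono mult_mono) auto
  finally have 3: "\<bar>real CARD('n) * bump R (k - 1) x - 2 * (real k - 1) / R\<^sup>2 * ((x \<bullet> x) * bump R (k - 2) x)\<bar> 
     \<le> (real CARD('n) + 2 * real k) * bump R (k - 2) x" by (simp add: algebra_simps)
  have "\<bar>laplacian (\<lambda>y. b * bump R k y) x\<bar> = \<bar>b\<bar> * (2 * real k / R\<^sup>2) * 
     \<bar>real CARD('n) * bump R (k - 1) x - 2 * (real k - 1) / R\<^sup>2 * ((x \<bullet> x) * bump R (k - 2) x)\<bar>"
    unfolding laplacian_bump[OF assms(1)] abs_mult by simp
  also have "\<dots> \<le> \<bar>b\<bar> * (2 * real k / R\<^sup>2) * ((real CARD('n) + 2 * real k) * bump R (k - 2) x)"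
    using 3 by (intro mult_left_mono) auto
  also have "\<dots> = 2 * real k * (real CARD('n) + 2 * real k) * (\<bar>b\<bar> / R\<^sup>2 * bump R (k - 2) x)"
    by (simp add: field_simps)
  finally show ?thesis .
qed

section \<open>Separated test functions, their Hadamard integrals and the weighted Young
  inequality\<close>

text \<open>Products inherit their derivatives factor by factor; \<open>k \<ge> 3\<close> keeps a
  positive power of the cutoff in the second derivatives. The support in \<open>x\<close> lies in
  the closed ball of radius \<open>R\<close>.\<close>

lemma separated_test_function:
  fixes \<theta> \<theta>' :: "real \<Rightarrow> real"
  assumes "k \<ge> 3" "R > 0"
    and der: "\<And>t. t \<in> {a..T} \<Longrightarrow> (\<theta> has_real_derivative \<theta>' t) (at t within {a..T})"
    and cont': "continuous_on {a..T} \<theta>'"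
  shows "(\<lambda>(t, x). \<theta> t * bump R k x) \<in> (test_functions a T :: (real \<times> (real ^ 'n::finite) \<Rightarrow> real) set)"
proof -
  have cont: "continuous_on {a..T} \<theta>"
    using der by (intro DERIV_continuous_on) auto
  have sl: "continuous_on (Q a T) (\<lambda>z. \<eta> (fst z) * g (snd z))" 
    if "continuous_on {a..T} \<eta>" "continuous_on UNIV g" for \<eta> and g :: "real ^ 'n \<Rightarrow> real"
    by (intro continuous_on_mult continuous_on_compose2[OF that(1) continuous_on_fst[OF continuous_on_id]]
       continuous_on_compose2[OF that(2) continuous_on_snd[OF continuous_on_id]]) (auto simp: Q_def)
  have "C12_on_slab a T (\<lambda>(t, x :: real ^ 'n). \<theta> t * bump R k x)"
    unfolding C12_on_slab_def
  proof (intro exI conjI ballI allI)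
    let ?Dx = "\<lambda>i x. - (2 * real k / R\<^sup>2) * (x $ i * bump R (k - 1) x)"
    let ?Dxx = "\<lambda>i j x. - (2 * real k / R\<^sup>2) * (axis j 1 $ i * bump R (k - 1) x
        - 2 * (real k - 1) / R\<^sup>2 * (x $ i * x $ j * bump R (k - 2) x))"
    show "continuous_on (Q a T) (\<lambda>(t, x :: real ^ 'n). \<theta> t * bump R k x)"
      using sl[OF cont continuous_on_bump, of R k] by (simp add: case_prod_unfold)
    \<comment> \<open>The derivatives were left schematic by \<open>exI\<close>; this claim and the
      two after it fix them.\<close>
    show "continuous_on (Q a T) (\<lambda>z :: real \<times> (real ^ 'n). \<theta>' (fst z) * bump R k (snd z))"
      by (rule sl[OF cont' continuous_on_bump])
    show "continuous_on (Q a T) (\<lambda>z. \<theta> (fst z) * ?Dx i (snd z))" for i :: 'n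
      by (rule sl[OF cont], intro continuous_intros)
    show "continuous_on (Q a T) (\<lambda>z. \<theta> (fst z) * ?Dxx i j (snd z))" for i j :: 'n
      by (rule sl[OF cont], intro continuous_intros)
    fix t x assume t: "t \<in> {a..T}"
    show "((\<lambda>s. case (s, x :: real ^ 'n) of (t, x) \<Rightarrow> \<theta> t * bump R k x) has_real_derivative
        \<theta>' (fst (t, x)) * bump R k (snd (t, x))) (at t within {a..T})"
      using DERIV_cmult_right[OF der[OF t], where c = "bump R k x"] by simp
    show "((\<lambda>h. case (t, x + h *\<^sub>R axis i 1) of (t, x) \<Rightarrow> \<theta> t * bump R k x) has_real_derivative
        \<theta> (fst (t, x)) * ?Dx i (snd (t, x))) (at 0)" for i
      using DERIV_cmult[OF bump_has_derivative[of k R x i], of "\<theta> t"] assms(1) by simp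
    show "((\<lambda>h. \<theta> (fst (t, x + h *\<^sub>R axis j 1)) * ?Dx i (snd (t, x + h *\<^sub>R axis j 1))) has_real_derivative
        \<theta> (fst (t, x)) * ?Dxx i j (snd (t, x))) (at 0)" for i j
      using DERIV_cmult[OF bump_has_derivative2[of k R x j i], of "\<theta> t"] assms(1) by simp
  qed
  moreover have "bounded {x :: real ^ 'n. \<exists>t\<in>{a..T}. \<theta> t * bump R k x \<noteq> 0}"
    by (rule bounded_subset[OF bounded_cball, of _ 0 R]) (use bump_eq_0[OF assms(2), of k] assms(1) in force)
  ultimately show ?thesis by (simp add: test_functions_def compact_closure)
qed

text \<open>Applies \<open>young_split\<close> with the weighted test function as \<open>B\<close>.
  In the dual term the powers of \<open>t\<close> combine to \<open>1/t\<close>, those of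
  \<open>q\<close> to \<open>m - 2 - 2k\<close> and those of \<open>y\<close> to
  \<open>l - 1 - k\<close>, where \<open>k = 1/(p-1)\<close>. The conditions on \<open>m\<close> and
  \<open>l\<close> make these exponents nonnegative, so the cutoffs drop out.\<close>

lemma weighted_young:
  fixes x D t \<tau> y q p \<gamma> :: real
  assumes "x \<ge> 0" "D \<ge> 0" "t > 0" "\<tau> > 0" "0 < y" "y \<le> 1" "0 < q" "q \<le> 1" "p > 1"
    and m: "m \<ge> 2" "2 + 2 / (p - 1) \<le> real m" and l: "l \<ge> 1" "1 + 1 / (p - 1) \<le> real l"
  shows "x * (D * (1 / t * q ^ (m - 2) * y ^ (l - 1)))
     \<le> \<tau> powr \<gamma> * x powr p * (1 / t * y ^ l * q ^ m)
       + D powr (1 + 1 / (p - 1)) * (1 / t * \<tau> powr (- (\<gamma> / (p - 1))))"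
proof -
  define k where "k = 1 / (p - 1)"
  have k: "k > 0" using assms by (simp add: k_def)
  define A where "A = D * (1 / t * q ^ (m - 2) * y ^ (l - 1))"
  define B where "B = \<tau> powr \<gamma> * (1 / t * y ^ l * q ^ m)"
  have AB: "A \<ge> 0" "B > 0" using assms by (auto simp: A_def B_def)
  have pw: "q ^ (m - 2) = q powr (real m - 2)" "y ^ (l - 1) = y powr (real l - 1)"
     "q ^ m = q powr real m" "y ^ l = y powr real l"
    using assms by (auto simp: powr_realpow[symmetric] of_nat_diff)
  have A: "A powr (1 + k) = D powr (1 + k) * (t powr (- (1 + k)) * q powr ((real m - 2) * (1 + k)) * y powr ((real l - 1) * (1 + k)))"
    using assms unfolding A_def pw(1,2) powr_minus_divide[of t]
    by (simp add: powr_mult powr_powr powr_divide)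
  have B: "B powr (- k) = \<tau> powr (- (\<gamma> * k)) * (t powr k * y powr (- (real l * k)) * q powr (- (real m * k)))"
    using assms unfolding B_def pw(3,4)
    by (simp add: powr_mult powr_powr powr_divide powr_minus_divide)
  have t: "t powr (- (1 + k)) * t powr k = 1 / t"
    using assms by (simp add: powr_add[symmetric] powr_minus divide_inverse)
  have q: "q powr ((real m - 2) * (1 + k)) * q powr (- (real m * k)) \<le> 1"
  proof -
    have "q powr ((real m - 2) * (1 + k)) * q powr (- (real m * k)) = q powr (real m - 2 - 2 * k)"
      by (simp add: powr_add[symmetric] algebra_simps)
    also have "\<dots> \<le> 1" using assms by (intro powr_le1) (auto simp: k_def)
    finally show ?thesis .
  qed
  have y: "y powr ((real l - 1) * (1 + k)) * y powr (- (real l * k)) \<le> 1"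
  proof -
    have "y powr ((real l - 1) * (1 + k)) * y powr (- (real l * k)) = y powr (real l - 1 - k)"
      by (simp add: powr_add[symmetric] algebra_simps)
    also have "\<dots> \<le> 1" using assms by (intro powr_le1) (auto simp: k_def)
    finally show ?thesis .
  qed
  have "A powr (1 + k) * B powr (- k) = D powr (1 + k) * (1 / t * \<tau> powr (- (\<gamma> * k)))
      * ((q powr ((real m - 2) * (1 + k)) * q powr (- (real m * k)))
         * (y powr ((real l - 1) * (1 + k)) * y powr (- (real l * k))))"
    unfolding A B t[symmetric] by (simp only: ac_simps)
  also have "\<dots> \<le> D powr (1 + k) * (1 / t * \<tau> powr (- (\<gamma> * k)))"
    using assms by (intro mult_right_le_one_le mult_le_one[OF q _ y] mult_nonneg_nonneg) auto
  finally have *: "A powr (1 + k) * B powr (- k) \<le> D powr (1 + k) * (1 / t * \<tau> powr (- (\<gamma> * k)))" .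
  have "x * A \<le> B * x powr p + A powr (1 + k) * B powr (- k)"
    using young_split[of x A B p] assms AB by (simp add: k_def)
  with * show ?thesis by (simp add: A_def B_def k_def mult_ac)
qed

text \<open>The redundant \<open>case\<close> makes the left-hand side match the weak formulation at a test function given as \<open>\<lambda>(t, x). \<dots>\<close>.\<close>

lemma hadamard_J_separated:
  fixes T b :: real and \<psi> :: "'a \<Rightarrow> real"
  assumes "0 < t" "t < T" "\<sigma> > 0" "l > 0"
  shows "hadamard_J T \<sigma> (\<lambda>(t, x). t * (case (t, x) of (t, x) \<Rightarrow> (1 / t * (b * ln (T / t) ^ l)) * \<psi> x)) (t, x)
     = Beta \<sigma> (real l + 1) / Gamma \<sigma> * b * ln (T / t) powr (real l + \<sigma>) * \<psi> x"
proof -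
  have "(LINT s:{t..T}|lebesgue. ln (s / t) powr (\<sigma> - 1) * (s * ((1 / s * (b * ln (T / s) ^ l)) * \<psi> x)) * (1 / s))
     = (LINT s:{t..T}|lebesgue. (b * \<psi> x) * (ln (s / t) powr (\<sigma> - 1) * ln (T / s) ^ l * (1 / s)))"
    by (rule set_lebesgue_integral_cong) (use assms in auto)
  also have "\<dots> = (b * \<psi> x) * (Beta \<sigma> (real l + 1) * ln (T / t) powr (real l + \<sigma>))"
    by (simp only: set_integral_mult_right log_beta_integral[OF assms])
  finally show ?thesis by (simp add: hadamard_J_def)
qed

text \<open>The closed form of \<open>hadamard_J\<close> holds on the open interval
  \<open>(0, T)\<close>, hence in a neighbourhood of \<open>t\<close>, so it may be differentiated
  in place of the integral.\<close>

lemma deriv_hadamard_J_separated: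
  fixes T b :: real and \<psi> :: "'a \<Rightarrow> real"
  assumes "0 < t" "t < T" "\<sigma> > 0" "l > 0"
  shows "deriv (\<lambda>\<tau>. hadamard_J T \<sigma> (\<lambda>(t, x). t * (case (t, x) of (t, x) \<Rightarrow> (1 / t * (b * ln (T / t) ^ l)) * \<psi> x)) (\<tau>, x)) t
     = - (Beta \<sigma> (real l + 1) / Gamma \<sigma> * b * (real l + \<sigma>) * ln (T / t) powr (real l + \<sigma> - 1) / t * \<psi> x)"
proof -
  let ?c = "Beta \<sigma> (real l + 1) / Gamma \<sigma> * b"
  have "\<forall>\<^sub>F \<tau> in nhds t. \<tau> \<in> {0<..<T}" using assms by (intro eventually_nhds_in_open) auto
  then have "\<forall>\<^sub>F \<tau> in nhds t. hadamard_J T \<sigma> (\<lambda>(t, x). t * (case (t, x) of (t, x) \<Rightarrow> (1 / t * (b * ln (T / t) ^ l)) * \<psi> x)) (\<tau>, x)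
      = ?c * ln (T / \<tau>) powr (real l + \<sigma>) * \<psi> x"
    by eventually_elim (rule hadamard_J_separated, use assms in auto)
  then have "deriv (\<lambda>\<tau>. hadamard_J T \<sigma> (\<lambda>(t, x). t * (case (t, x) of (t, x) \<Rightarrow> (1 / t * (b * ln (T / t) ^ l)) * \<psi> x)) (\<tau>, x)) t
    = deriv (\<lambda>\<tau>. ?c * ln (T / \<tau>) powr (real l + \<sigma>) * \<psi> x) t"
    by (rule deriv_cong_ev) simp
  also have "\<dots> = ?c * ((real l + \<sigma>) * ln (T / t) powr (real l + \<sigma> - of_nat 1) * (- 1 / t)) * \<psi> x"
  proof -
    have D: "((\<lambda>\<tau>. ln (T / \<tau>)) has_real_derivative - 1 / t) (at t)"
      using assms by (auto intro!: derivative_eq_intros simp: field_simps power2_eq_square)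
    show ?thesis
      by (intro DERIV_imp_deriv DERIV_cmult_right DERIV_cmult DERIV_fun_powr D) (use assms in auto)
  qed
  finally show ?thesis by simp
qed

text \<open>The two time slices are hyperplanes. Removing them leaves \<open>a < t < T\<close>,
  where \<open>ln (t/a) > 0\<close> and the formula for the time derivative of the Hadamard integral
  is available.\<close>

lemma AE_slab_interior:
  "AE z in lebesgue. fst z \<noteq> (a :: real) \<and> fst (z :: real \<times> 'b::euclidean_space) \<noteq> T"
proof -
  have "negligible {z :: real \<times> 'b. z \<bullet> (1, 0) = c}" for c
    by (rule negligible_standard_hyperplane) (simp add: Basis_prod_def)
  then have "AE z :: real \<times> 'b in lebesgue. z \<notin> {z. z \<bullet> (1, 0) = a}" "AE z :: real \<times> 'b in lebesgue. z \<notin> {z. z \<bullet> (1, 0) = T}"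
    unfolding negligible_iff_null_sets by (blast intro: AE_not_in)+
  then show ?thesis by eventually_elim (auto simp: inner_prod_def)
qed

lemma cutoff_time_derivative:
  fixes a T b :: real
  assumes "0 < a"
  shows "\<exists>\<theta>'. continuous_on {a..T} \<theta>' \<and> (\<forall>t\<in>{a..T}. 
     ((\<lambda>t. 1 / t * (b * ln (T / t) ^ l)) has_real_derivative \<theta>' t) (at t within {a..T}))"
proof (intro exI conjI ballI)
  let ?d = "\<lambda>t. - (1 / t\<^sup>2) * (b * ln (T / t) ^ l) + (b * (real l * ln (T / t) ^ (l - 1) * (- 1 / t))) * (1 / t)"
  show "continuous_on {a..T} ?d" using assms by (intro continuous_intros) auto
  fix t assume t: "t \<in> {a..T}"
  have D: "((\<lambda>t. ln (T / t)) has_real_derivative - 1 / t) (at t within {a..T})"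
    using assms t by (auto intro!: derivative_eq_intros simp: field_simps power2_eq_square)
  have E: "((\<lambda>t. 1 / t) has_real_derivative - (1 / t\<^sup>2)) (at t within {a..T})"
    using assms t by (auto intro!: derivative_eq_intros simp: field_simps power2_eq_square)
  show "((\<lambda>t. 1 / t * (b * ln (T / t) ^ l)) has_real_derivative ?d t) (at t within {a..T})"
    using DERIV_mult[OF E DERIV_cmult[OF DERIV_power[OF D, of l], of b]] by (simp add: mult_ac)
qed

section \<open>The estimate at scale R\<close>

text \<open>Treats both real equations of the system at once: \<open>c\<close> is the real or
  imaginary part of the coefficient, \<open>g\<close> the matching combination of the data, and
  \<open>U\<close>, \<open>V\<close> the combinations of components of \<open>u\<close> in the two
  integrals on the right. Dividing by \<open>c\<close> covers both signs.\<close>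

lemma scaled_test_estimate:
  fixes a \<alpha> \<gamma> p c :: real and g :: "real ^ 'n \<Rightarrow> real"
    and U V :: "real \<times> (real ^ 'n) \<Rightarrow> real" and u :: "real \<times> (real ^ 'n) \<Rightarrow> complex"
  assumes a: "a > 0" and \<alpha>: "0 < \<alpha>" "\<alpha> < 1" and p: "p > 1" "p > 1 + \<gamma>" and c: "c \<noteq> 0"
    and loc: "L1_loc_on ({a..} \<times> UNIV) (\<lambda>(t, x). ln (t / a) powr \<gamma> * cmod (u (t, x)) powr p)"
    and U: "\<And>z. \<bar>U z\<bar> \<le> 2 * cmod (u z)" and V: "\<And>z. \<bar>V z\<bar> \<le> 2 * cmod (u z)"
    and bal: "\<And>T \<phi>. T > a \<Longrightarrow> \<phi> \<in> test_functions a T \<Longrightarrow>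
        c * (LINT (t, x):Q a T|lebesgue. ln (t / a) powr \<gamma> * cmod (u (t, x)) powr p * \<phi> (t, x))
        + (LINT x|lebesgue. g x * hadamard_J T (1 - \<alpha>) (\<lambda>(t, x). t * \<phi> (t, x)) (a, x))
        = (LINT (t, x):Q a T|lebesgue. U (t, x) * laplacian (\<lambda>y. \<phi> (t, y)) x)
        - (LINT (t, x):Q a T|lebesgue.
             V (t, x) * deriv (\<lambda>\<tau>. hadamard_J T (1 - \<alpha>) (\<lambda>(t, x). t * \<phi> (t, x)) (\<tau>, x)) t)"
  shows "\<exists>m K. \<forall>R>0. (LINT x|lebesgue. g x * bump R m x) / c
      \<le> K * R powr (real CARD('n) - 2 / (p - 1) * (1 + \<gamma> / \<alpha>))"
proof -
  define k where "k = 1 / (p - 1)"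
  have k: "k > 0" using p by (simp add: k_def)
  \<comment> \<open>This is \<open>p > 1 + \<gamma>\<close>; it makes
    \<open>ln (t/a) powr (- (\<gamma> * k))\<close> integrable against \<open>dt/t\<close> at
    \<open>t = a\<close>.\<close>
  have \<gamma>k: "\<gamma> * k < 1" using p by (simp add: k_def field_simps)
  \<comment> \<open>Both powers are large enough for \<open>weighted_young\<close>; the extra 3
    secures \<open>m \<ge> 3\<close>, as second derivatives of the cutoff require.\<close>
  define m where "m = nat \<lceil>2 + 2 * k\<rceil> + 3"
  define l where "l = nat \<lceil>1 + k\<rceil> + 1"
  have m: "m \<ge> 3" "2 + 2 * k \<le> real m" by (simp add: m_def, unfold m_def, linarith)
  have l: "l > 0" "1 + k \<le> real l" by (simp add: l_def, unfold l_def, linarith)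
  define \<sigma> where "\<sigma> = 1 - \<alpha>"
  have \<sigma>: "\<sigma> > 0" using \<alpha> by (simp add: \<sigma>_def)
  define C0 where "C0 = Beta \<sigma> (real l + 1) / Gamma \<sigma>"
  have C0: "C0 > 0" using \<sigma> unfolding C0_def Beta_def
    by (intro divide_pos_pos mult_pos_pos Gamma_real_pos) auto
  define K1 where "K1 = 2 * real m * (real CARD('n) + 2 * real m)"
  define K2 where "K2 = C0 * (real l + \<sigma>)"
  have K: "K1 \<ge> 0" "K2 \<ge> 0" using C0 \<sigma> by (auto simp: K1_def K2_def)
  \<comment> \<open>\<open>K1\<close> comes from the Laplacian and \<open>K2\<close> from the time
    derivative. With \<open>D = M / R^2\<close> below,
    \<open>\<bar>c\<bar> / 2 * D = 2 * (K1 + K2) / R^2\<close>, so each of the two integrals absorbs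
    at most half of the nonlinear term.\<close>
  define M where "M = 4 / \<bar>c\<bar> * (K1 + K2)"
  have M: "M \<ge> 0" using K by (simp add: M_def)
  define K3 where "K3 = M powr (1 + k) / (1 - \<gamma> * k) * unit_ball_vol (real CARD('n)) / C0"
  have main: "(LINT x|lebesgue. g x * bump R m x) / c
      \<le> K3 * R powr (real CARD('n) - 2 / (p - 1) * (1 + \<gamma> / \<alpha>))" if R: "R > 0" for R
  proof -
    \<comment> \<open>The scaling that balances the time derivative of order \<open>\<alpha>\<close>
      with the Laplacian: \<open>L powr (- \<alpha>) = 1 / R^2\<close>.\<close>
    define L where "L = R powr (2 / \<alpha>)"
    have L: "L > 0" using R by (simp add: L_def)
    have LR: "L powr (- \<alpha>) = 1 / R\<^sup>2"
      using R \<alpha> by (simp add: L_def powr_powr powr_minus_divide powr_realpow[of R 2, simplified])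
    define T where "T = a * exp L"
    have T: "T > a" using a L by (simp add: T_def)
    have Ta: "ln (T / a) = L" using a by (simp add: T_def)
    define b where "b = 1 / L ^ l"
    define \<phi> where "\<phi> = (\<lambda>(t, x :: real ^ 'n). (1 / t * (b * ln (T / t) ^ l)) * bump R m x)"
    obtain \<theta>' where \<theta>': "continuous_on {a..T} \<theta>'" "\<And>t. t \<in> {a..T} \<Longrightarrow>
       ((\<lambda>t. 1 / t * (b * ln (T / t) ^ l)) has_real_derivative \<theta>' t) (at t within {a..T})"
      using cutoff_time_derivative[OF a, of T b l] by blast
    have \<phi>: "\<phi> \<in> test_functions a T"
      unfolding \<phi>_def by (rule separated_test_function[OF m(1) R \<theta>'(2,1)])
    define E where "E = (\<lambda>(t, x). ln (t / a) powr \<gamma> * cmod (u (t, x)) powr p * \<phi> (t, x))"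
    define D where "D = M / R\<^sup>2"
    have D: "D \<ge> 0" using M by (simp add: D_def)
    \<comment> \<open>\<open>E\<close> is the density of the nonlinear term; \<open>G\<close> is the
      density of Young's remainder, confined to the ball that supports the cutoff.\<close>
    define G where "G = (\<lambda>(t, x :: real ^ 'n). D powr (1 + k) * (1 / t * ln (t / a) powr (- (\<gamma> * k)) * indicator (cball 0 R) x))"
    have Gi: "set_integrable lebesgue (Q a T) G"
      using slab_integral(1)[OF a T, of "- (\<gamma> * k)" R] \<gamma>k
      unfolding G_def case_prod_unfold by (intro set_integrable_mult_right) simp
    have GI: "(LINT z:Q a T|lebesgue. G z) = D powr (1 + k) * (L powr (1 - \<gamma> * k) / (1 - \<gamma> * k)
         * (unit_ball_vol (real CARD('n)) * R ^ CARD('n)))"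
    proof -
      have "(LINT z:Q a T|lebesgue. G z) = D powr (1 + k) * 
        (LINT (t, x):(Q a T :: (real \<times> (real^'n)) set)|lebesgue. 1 / t * ln (t / a) powr (- (\<gamma> * k)) * indicator (cball 0 R) x)"
        by (simp only: G_def case_prod_unfold set_integral_mult_right)
      also have "\<dots> = D powr (1 + k) * (L powr (- (\<gamma> * k) + 1) / (- (\<gamma> * k) + 1) * measure lebesgue (cball (0 :: real^'n) R))"
        using \<gamma>k by (subst slab_integral(2)[OF a T]) (auto simp: Ta)
      finally show ?thesis using R by (simp add: content_cball)
    qed
    have E0: "E z \<ge> 0" if "z \<in> Q a T" for z
      using that a L bump_nonneg[of R m "snd z"] by (auto simp: E_def \<phi>_def Q_def b_def case_prod_unfold)
    \<comment> \<open>The slab is not compact, so local integrability is used on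
      \<open>{a..T} \<times> cball 0 R\<close>, where \<open>\<phi>\<close> is bounded and outside
      of which it vanishes in the slab.\<close>
    have Ei: "set_integrable lebesgue (Q a T) E"
    proof -
      let ?S = "{a..T} \<times> cball (0 :: real ^ 'n) R"
      have S: "compact ?S" by (intro compact_Times) auto
      have "continuous_on (Q a T) \<phi>"
        using \<phi> by (auto simp: test_functions_def C12_on_slab_def)
      then have ct: "continuous_on ?S \<phi>" by (rule continuous_on_subset) (auto simp: Q_def)
      have w: "set_integrable lebesgue ?S (\<lambda>(t, x). ln (t / a) powr \<gamma> * cmod (u (t, x)) powr p)"
        using loc S unfolding L1_loc_on_def by (auto simp del: mem_cball)
      have Si: "set_integrable lebesgue ?S (\<lambda>z. \<phi> z * (case z of (t, x) \<Rightarrow> ln (t / a) powr \<gamma> * cmod (u (t, x)) powr p))"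
        using S compact_imp_bounded[OF compact_continuous_image[OF ct S]]
        by (intro absolutely_integrable_bounded_measurable_product[OF bilinear_times] w
              continuous_imp_measurable_on_sets_lebesgue ct) (auto simp: lmeasurable_compact fmeasurableD)
      have eq: "(\<lambda>z. indicator ?S z *\<^sub>R (\<phi> z * (case z of (t, x) \<Rightarrow> ln (t / a) powr \<gamma> * cmod (u (t, x)) powr p)))
          = (\<lambda>z. indicator (Q a T) z *\<^sub>R E z)"
        using bump_eq_0[OF R, of m] m
        by (auto simp: fun_eq_iff E_def \<phi>_def Q_def indicator_def split: if_splits)
      show ?thesis using Si unfolding set_integrable_def eq .
    qed
    \<comment> \<open>The pointwise absorption, stated for an arbitrary value \<open>F\<close> so
      that it serves both integrals. The variable \<open>y\<close> abbreviates the normalised time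
      cutoff.\<close>
    have bound: "\<bar>indicator (Q a T) (t, x) *\<^sub>R F\<bar> \<le> indicator (Q a T) (t, x) *\<^sub>R (\<bar>c\<bar> / 2 * (E (t, x) + G (t, x)))"
      if t: "t \<noteq> a" "t \<noteq> T"
        and F: "\<And>y. a < t \<Longrightarrow> t < T \<Longrightarrow> y = ln (T / t) / L \<Longrightarrow>
             \<bar>F\<bar> \<le> 2 * cmod (u (t, x)) * ((K1 + K2) * (1 / t * bump R (m - 2) x * y ^ (l - 1) / R\<^sup>2))"
      for t and x :: "real ^ 'n" and F
    proof (cases "a < t \<and> t < T")
      case True
      then have t0: "0 < t" and \<tau>: "ln (t / a) > 0" using a by auto
      define y where "y = ln (T / t) / L"
      have y0: "y > 0" using True t0 L by (simp add: y_def)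
      have "ln (T / t) \<le> ln (T / a)" using True a t0 by (simp add: field_simps)
      then have y1: "y \<le> 1" using L by (simp add: y_def Ta)
      define q where "q = bump R 1 x"
      have q: "0 \<le> q" "q \<le> 1" by (auto simp: q_def bump_nonneg bump_le_1)
      have qp: "bump R j x = q ^ j" for j by (simp add: q_def bump_eq_power[of R j])
      have \<phi>y: "\<phi> (t, x) = 1 / t * y ^ l * q ^ m"
        by (simp add: \<phi>_def b_def y_def qp power_divide)
      have in_Q: "(t, x) \<in> Q a T" using True by (simp add: Q_def)
      have "\<bar>F\<bar> \<le> 2 * cmod (u (t, x)) * ((K1 + K2) * (1 / t * q ^ (m - 2) * y ^ (l - 1) / R\<^sup>2))"
        using F[of y] True by (simp add: y_def qp)
      also have "\<dots> = \<bar>c\<bar> / 2 * (cmod (u (t, x)) * (D * (1 / t * q ^ (m - 2) * y ^ (l - 1))))"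
      proof -
        have cD: "\<bar>c\<bar> / 2 * D = 2 * (K1 + K2) / R\<^sup>2" using c R by (simp add: D_def M_def divide_simps)
        have "2 * w * (\<kappa> * (v / R\<^sup>2)) = 2 * \<kappa> / R\<^sup>2 * (w * v)" for w v \<kappa> :: real
          by simp
        then show ?thesis by (simp only: cD[symmetric]) (simp only: mult_ac)
      qed
      also have "\<dots> \<le> \<bar>c\<bar> / 2 * (E (t, x) + G (t, x))"
      proof (rule mult_left_mono)
        show "cmod (u (t, x)) * (D * (1 / t * q ^ (m - 2) * y ^ (l - 1))) \<le> E (t, x) + G (t, x)"
        \<comment> \<open>\<open>weighted_young\<close> needs \<open>q > 0\<close>. Where the cutoff
          vanishes, so does the left-hand side, because \<open>m - 2 > 0\<close>.\<close>
        proof (cases "q = 0")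
          case True
          then have "q ^ (m - 2) = 0" using m by simp
          moreover have "G (t, x) \<ge> 0" using D t0 by (simp add: G_def)
          ultimately show ?thesis using E0[OF in_Q] by (simp only: mult_zero_left mult_zero_right)
        next
          case False
          then have "x \<in> cball 0 R" using bump_eq_0[OF R, of 1 x] by (auto simp: q_def)
          then have "G (t, x) = D powr (1 + k) * (1 / t * ln (t / a) powr (- (\<gamma> * k)))"
            by (simp add: G_def)
          moreover have "E (t, x) = ln (t / a) powr \<gamma> * cmod (u (t, x)) powr p * (1 / t * y ^ l * q ^ m)"
            by (simp add: E_def \<phi>y)
          ultimately show ?thesis
            using weighted_young[of "cmod (u (t, x))" D t "ln (t / a)" y q p m l \<gamma>] False q y0 y1 t0 \<tau> D p m l
            by (simp add: k_def)
        qed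
      qed simp
      finally show ?thesis using in_Q by simp
    next
      case False
      then have "(t, x) \<notin> Q a T" using t by (auto simp: Q_def)
      then show ?thesis by simp
    qed
    define I where "I = (LINT z:Q a T|lebesgue. E z)"
    define J where "J = (LINT z:Q a T|lebesgue. G z)"
    have EGi: "set_integrable lebesgue (Q a T) (\<lambda>z. \<bar>c\<bar> / 2 * (E z + G z))"
      using Ei Gi by (intro set_integrable_mult_right set_integral_add) auto
    have EGI: "(LINT z:Q a T|lebesgue. \<bar>c\<bar> / 2 * (E z + G z)) = \<bar>c\<bar> / 2 * (I + J)"
      using Ei Gi by (simp only: set_integral_mult_right set_integral_add I_def J_def)
    have int_bound: "\<bar>LINT (t, x):Q a T|lebesgue. F t x\<bar> \<le> \<bar>c\<bar> / 2 * (I + J)"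
      if F: "\<And>t x y. a < t \<Longrightarrow> t < T \<Longrightarrow> y = ln (T / t) / L \<Longrightarrow>
             \<bar>F t x\<bar> \<le> 2 * cmod (u (t, x)) * ((K1 + K2) * (1 / t * bump R (m - 2) x * y ^ (l - 1) / R\<^sup>2))"
      for F :: "real \<Rightarrow> real ^ 'n \<Rightarrow> real"
      unfolding EGI[symmetric] unfolding set_lebesgue_integral_def
    proof (rule abs_integral_le_AE)
      show "integrable lebesgue (\<lambda>z. indicator (Q a T) z *\<^sub>R (\<bar>c\<bar> / 2 * (E z + G z)))"
        using EGi by (simp add: set_integrable_def)
      show "AE z in lebesgue. \<bar>indicator (Q a T) z *\<^sub>R (case z of (t, x) \<Rightarrow> F t x)\<bar>
          \<le> indicator (Q a T) z *\<^sub>R (\<bar>c\<bar> / 2 * (E z + G z))"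
        using AE_slab_interior[of a T]
      proof eventually_elim
        case (elim z)
        obtain t x where z: "z = (t, x)" by force
        show ?case unfolding z prod.case using elim F[of t _ x] z by (intro bound) auto
      qed
    qed
    \<comment> \<open>For the third claim, \<open>ln (T/t) = L * y\<close> and
      \<open>b = L powr (- l)\<close> give
      \<open>L powr (- \<alpha>) * y powr (l - \<alpha>)\<close>; then \<open>y \<le> 1\<close> and
      \<open>\<alpha> < 1\<close> allow the exponent to drop to \<open>l - 1\<close>.\<close>
    have ypow: "0 \<le> y ^ (l - 1)" "y ^ l \<le> y ^ (l - 1)" "b * ln (T / t) powr (real l + \<sigma> - 1) \<le> y ^ (l - 1) / R\<^sup>2"
      "b * ln (T / t) ^ l = y ^ l"
      if "a < t" "t < T" "y = ln (T / t) / L" for t y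
    proof -
      have t0: "t > 0" using that a by simp
      have y0: "y > 0" using that t0 L by simp
      have "ln (T / t) \<le> ln (T / a)" using that a t0 by (simp add: field_simps)
      then have y1: "y \<le> 1" using L that by (simp add: Ta)
      show "0 \<le> y ^ (l - 1)" using y0 by simp
      show "y ^ l \<le> y ^ (l - 1)" using y0 y1 by (intro power_decreasing) auto
      show "b * ln (T / t) ^ l = y ^ l" by (simp add: that b_def power_divide)
      have ln: "ln (T / t) = L * y" using that L by simp
      have "b * ln (T / t) powr (real l + \<sigma> - 1) = L powr (- real l) * (L powr (real l - \<alpha>) * y powr (real l - \<alpha>))"
        unfolding ln using L y0 by (simp add: b_def \<sigma>_def powr_mult powr_minus_divide powr_realpow)
      also have "\<dots> = L powr (- \<alpha>) * y powr (real l - \<alpha>)"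
        by (simp add: powr_add[symmetric])
      also have "\<dots> \<le> L powr (- \<alpha>) * y powr (real (l - 1))"
        using y0 y1 \<alpha> l by (intro mult_left_mono powr_mono') (auto simp: of_nat_diff)
      finally show "b * ln (T / t) powr (real l + \<sigma> - 1) \<le> y ^ (l - 1) / R\<^sup>2"
        using y0 by (simp add: LR powr_realpow)
    qed
    have A1: "\<bar>LINT (t, x):Q a T|lebesgue. U (t, x) * laplacian (\<lambda>y. \<phi> (t, y)) x\<bar> \<le> \<bar>c\<bar> / 2 * (I + J)"
    proof (rule int_bound)
      fix t y :: real and x :: "real ^ 'n" assume t: "a < t" "t < T" "y = ln (T / t) / L"
      have t0: "t > 0" using t a by simp
      have "\<bar>laplacian (\<lambda>y. \<phi> (t, y)) x\<bar> \<le> K1 * (\<bar>1 / t * y ^ l\<bar> / R\<^sup>2 * bump R (m - 2) x)"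
        using laplacian_bump_bound[OF m(1) R, of "1 / t * y ^ l" x] ypow(4)[OF t]
        by (simp add: \<phi>_def K1_def)
      also have "\<dots> \<le> (K1 + K2) * (1 / t * y ^ (l - 1) / R\<^sup>2 * bump R (m - 2) x)"
        using ypow(1,2)[OF t] K t0 t L bump_nonneg[of R "m - 2" x]
        by (intro mult_mono divide_right_mono) (auto simp: abs_mult intro!: divide_right_mono)
      finally have "\<bar>U (t, x)\<bar> * \<bar>laplacian (\<lambda>y. \<phi> (t, y)) x\<bar> \<le> 2 * cmod (u (t, x)) * ((K1 + K2) * (1 / t * y ^ (l - 1) / R\<^sup>2 * bump R (m - 2) x))"
        using U by (intro mult_mono) auto
      then show "\<bar>U (t, x) * laplacian (\<lambda>y. \<phi> (t, y)) x\<bar>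
         \<le> 2 * cmod (u (t, x)) * ((K1 + K2) * (1 / t * bump R (m - 2) x * y ^ (l - 1) / R\<^sup>2))"
        by (simp add: abs_mult mult_ac)
    qed
    have A2: "\<bar>LINT (t, x):Q a T|lebesgue. V (t, x) * deriv (\<lambda>\<tau>. hadamard_J T (1 - \<alpha>) (\<lambda>(t, x). t * \<phi> (t, x)) (\<tau>, x)) t\<bar>
       \<le> \<bar>c\<bar> / 2 * (I + J)"
    proof (rule int_bound)
      fix t y :: real and x :: "real ^ 'n" assume t: "a < t" "t < T" "y = ln (T / t) / L"
      have t0: "t > 0" using t a by simp
      let ?d = "deriv (\<lambda>\<tau>. hadamard_J T (1 - \<alpha>) (\<lambda>(t, x). t * \<phi> (t, x)) (\<tau>, x)) t"
      have "?d = - (C0 * b * (real l + \<sigma>) * ln (T / t) powr (real l + \<sigma> - 1) / t * bump R m x)"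
        unfolding \<phi>_def C0_def \<sigma>_def[symmetric] using t0 t \<sigma> l by (intro deriv_hadamard_J_separated) auto
      also have "\<dots> = - (K2 * (1 / t * (b * ln (T / t) powr (real l + \<sigma> - 1)) * bump R m x))"
        by (simp add: K2_def)
      finally have "\<bar>?d\<bar> = K2 * (1 / t * (b * ln (T / t) powr (real l + \<sigma> - 1)) * bump R m x)"
        using K t0 L bump_nonneg[of R m x] by (simp add: abs_mult b_def)
      also have "\<dots> \<le> (K1 + K2) * (1 / t * (y ^ (l - 1) / R\<^sup>2) * bump R (m - 2) x)"
      proof -
        have "bump R m x \<le> bump R (m - 2) x"
          unfolding bump_eq_power[of R m] bump_eq_power[of R "m - 2"]
          by (intro power_decreasing) (auto simp: bump_nonneg bump_le_1)
        then show ?thesis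
          using ypow(1,3)[OF t] K t0 L bump_nonneg[of R _ x]
          by (intro mult_mono mult_nonneg_nonneg) (auto simp: b_def)
      qed
      finally have "\<bar>V (t, x)\<bar> * \<bar>?d\<bar> \<le> 2 * cmod (u (t, x)) * ((K1 + K2) * (1 / t * (y ^ (l - 1) / R\<^sup>2) * bump R (m - 2) x))"
        using V by (intro mult_mono) auto
      then show "\<bar>V (t, x) * ?d\<bar>
         \<le> 2 * cmod (u (t, x)) * ((K1 + K2) * (1 / t * bump R (m - 2) x * y ^ (l - 1) / R\<^sup>2))"
        by (simp add: abs_mult mult_ac)
    qed
    have data: "(LINT x|lebesgue. g x * hadamard_J T (1 - \<alpha>) (\<lambda>(t, x). t * \<phi> (t, x)) (a, x))
       = C0 * L powr \<sigma> * (LINT x|lebesgue. g x * bump R m x)"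
    proof -
      have "hadamard_J T (1 - \<alpha>) (\<lambda>(t, x). t * \<phi> (t, x)) (a, x) = C0 * L powr \<sigma> * bump R m x" for x
      proof -
        have "hadamard_J T (1 - \<alpha>) (\<lambda>(t, x). t * \<phi> (t, x)) (a, x) = C0 * b * ln (T / a) powr (real l + \<sigma>) * bump R m x"
          unfolding \<phi>_def C0_def \<sigma>_def[symmetric] using a T \<sigma> l by (intro hadamard_J_separated) auto
        also have "\<dots> = C0 * L powr \<sigma> * bump R m x"
          unfolding Ta using L by (simp add: b_def powr_add powr_realpow)
        finally show ?thesis .
      qed
      then have "(LINT x|lebesgue. g x * hadamard_J T (1 - \<alpha>) (\<lambda>(t, x). t * \<phi> (t, x)) (a, x))
        = (LINT x|lebesgue. C0 * L powr \<sigma> * (g x * bump R m x))" by (simp only: mult_ac)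
      then show ?thesis by simp
    qed
    define S where "S = (LINT x|lebesgue. g x * bump R m x)"
    \<comment> \<open>The two halves add up to \<open>\<bar>c\<bar> * (I + J)\<close>. After
      division by \<open>c\<close> the nonlinear term \<open>I\<close> cancels and only the
      remainder \<open>J\<close> bounds the data.\<close>
    have "\<bar>c * I + C0 * L powr \<sigma> * S\<bar> \<le> \<bar>c\<bar> * (I + J)"
      using bal[OF T \<phi>] A1 A2 data unfolding S_def I_def E_def by simp
    then have "\<bar>c * I + C0 * L powr \<sigma> * S\<bar> / \<bar>c\<bar> \<le> I + J" using c by (simp add: field_simps)
    then have "\<bar>(c * I + C0 * L powr \<sigma> * S) / c\<bar> \<le> I + J" by (simp only: abs_divide)
    then have "(c * I + C0 * L powr \<sigma> * S) / c \<le> I + J" by linarith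
    then have "C0 * L powr \<sigma> * (S / c) \<le> J" using c by (simp add: add_divide_distrib)
    then have "S / c \<le> J / (C0 * L powr \<sigma>)" using C0 L by (simp add: pos_le_divide_eq mult_ac)
    also have "\<dots> = K3 * (L powr (1 - \<gamma> * k) / L powr \<sigma> * R ^ CARD('n) / (R\<^sup>2) powr (1 + k))"
      using M R unfolding J_def GI D_def K3_def by (simp add: powr_divide mult_ac)
    \<comment> \<open>Exponent count: time contributes
      \<open>L powr (\<alpha> - \<gamma> * k)\<close>, the ball \<open>R ^ CARD('n)\<close>, and
      \<open>D powr (1 + k)\<close> the factor \<open>R powr (- 2 * (1 + k))\<close>.\<close>
    also have "L powr (1 - \<gamma> * k) / L powr \<sigma> * R ^ CARD('n) / (R\<^sup>2) powr (1 + k)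
       = R powr (2 / \<alpha> * (\<alpha> - \<gamma> * k) + real CARD('n) - 2 * (1 + k))"
    proof -
      have "L powr (1 - \<gamma> * k) / L powr \<sigma> = R powr (2 / \<alpha> * (\<alpha> - \<gamma> * k))"
      proof -
        have "1 - \<gamma> * k - \<sigma> = \<alpha> - \<gamma> * k" by (simp add: \<sigma>_def)
        then show ?thesis by (simp only: powr_diff[symmetric]) (simp only: L_def powr_powr)
      qed
      moreover have "R ^ CARD('n) = R powr real CARD('n)" using R by (simp add: powr_realpow)
      moreover have "(R\<^sup>2) powr (1 + k) = R powr (2 * (1 + k))"
        using R powr_powr[of R 2 "1 + k"] powr_realpow[of R 2] by simp
      ultimately show ?thesis using R by (simp add: powr_add powr_diff)
    qed
    also have "2 / \<alpha> * (\<alpha> - \<gamma> * k) + real CARD('n) - 2 * (1 + k) = real CARD('n) - 2 / (p - 1) * (1 + \<gamma> / \<alpha>)"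
    proof -
      have "2 / (p - 1) = 2 * k" by (simp add: k_def)
      then show ?thesis using \<alpha> by (simp only:) (simp add: field_simps)
    qed
    finally show ?thesis by (simp only: S_def)
  qed
  then show ?thesis by blast
qed

section \<open>Passage to the limit and the two real equations\<close>

text \<open>As \<open>R\<close> grows, the cutoffs tend to 1 pointwise and the data integrals
  converge by domination with \<open>\<bar>g\<bar>\<close>, while the bound at scale
  \<open>R\<close> tends to 0. Hence \<open>(LINT x|lebesgue. g x) / c \<le> 0\<close>, against the
  sign condition.\<close>

lemma no_weak_balance:
  fixes a \<alpha> \<gamma> p c :: real and g :: "real ^ 'n \<Rightarrow> real"
    and U V :: "real \<times> (real ^ 'n) \<Rightarrow> real" and u :: "real \<times> (real ^ 'n) \<Rightarrow> complex"
  assumes a: "a > 0" and \<alpha>: "0 < \<alpha>" "\<alpha> < 1"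
    and p: "p > 1" "p > 1 + \<gamma>" "p < 1 + 2 * (\<alpha> + \<gamma>) / (real CARD('n) * \<alpha>)"
    and g: "integrable lebesgue g" and cg: "c * (LINT x|lebesgue. g x) > 0"
    and loc: "L1_loc_on ({a..} \<times> UNIV) (\<lambda>(t, x). ln (t / a) powr \<gamma> * cmod (u (t, x)) powr p)"
    and U: "\<And>z. \<bar>U z\<bar> \<le> 2 * cmod (u z)" and V: "\<And>z. \<bar>V z\<bar> \<le> 2 * cmod (u z)"
    and bal: "\<And>T \<phi>. T > a \<Longrightarrow> \<phi> \<in> test_functions a T \<Longrightarrow>
        c * (LINT (t, x):Q a T|lebesgue. ln (t / a) powr \<gamma> * cmod (u (t, x)) powr p * \<phi> (t, x))
        + (LINT x|lebesgue. g x * hadamard_J T (1 - \<alpha>) (\<lambda>(t, x). t * \<phi> (t, x)) (a, x))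
        = (LINT (t, x):Q a T|lebesgue. U (t, x) * laplacian (\<lambda>y. \<phi> (t, y)) x)
        - (LINT (t, x):Q a T|lebesgue.
             V (t, x) * deriv (\<lambda>\<tau>. hadamard_J T (1 - \<alpha>) (\<lambda>(t, x). t * \<phi> (t, x)) (\<tau>, x)) t)"
  shows False
proof -
  have c: "c \<noteq> 0" using cg by auto
  let ?e = "real CARD('n) - 2 / (p - 1) * (1 + \<gamma> / \<alpha>)"
  \<comment> \<open>The upper bound on \<open>p\<close> is rearranged into negativity of the
    exponent of \<open>R\<close>.\<close>
  have "(p - 1) * (real CARD('n) * \<alpha>) < 2 * (\<alpha> + \<gamma>)"
    using p \<alpha> by (simp add: pos_less_divide_eq[symmetric] less_diff_eq add.commute)
  then have "real CARD('n) * \<alpha> < 2 / (p - 1) * (\<alpha> + \<gamma>)"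
    using p by (simp add: pos_less_divide_eq mult_ac)
  then have "real CARD('n) < 2 / (p - 1) * (\<alpha> + \<gamma>) / \<alpha>"
    using \<alpha> by (subst pos_less_divide_eq) simp_all
  also have "\<dots> = 2 / (p - 1) * (1 + \<gamma> / \<alpha>)"
    using \<alpha> p by (simp add: divide_simps)
  finally have e: "?e < 0" by simp
  obtain m K where *: "\<And>R. R > 0 \<Longrightarrow> (LINT x|lebesgue. g x * bump R m x) / c \<le> K * R powr ?e"
    using scaled_test_estimate[OF a \<alpha> p(1,2) c loc U V bal] by auto
  have "((\<lambda>R. LINT x|lebesgue. g x * bump R m x) \<longlongrightarrow> (LINT x|lebesgue. g x)) at_top"
  proof (rule integral_dominated_convergence_at_top)
    show "integrable lebesgue (\<lambda>x. \<bar>g x\<bar>)" using g by simp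
    show gm: "g \<in> borel_measurable lebesgue" using g by simp
    have "bump R m \<in> borel_measurable lebesgue" for R
      by (simp add: measurable_completion)
    then show "(\<lambda>x. g x * bump R m x) \<in> borel_measurable lebesgue" for R
      using gm by (intro borel_measurable_times)
    have "\<bar>g x * bump R m x\<bar> \<le> \<bar>g x\<bar>" for R x
      using bump_nonneg[of R m x] bump_le_1[of R m x] by (simp add: abs_mult mult_left_le)
    then show "\<forall>\<^sub>F R in at_top. AE x in lebesgue. norm (g x * bump R m x) \<le> \<bar>g x\<bar>" by simp
    show "AE x in lebesgue. ((\<lambda>R. g x * bump R m x) \<longlongrightarrow> g x) at_top"
      using tendsto_mult[OF tendsto_const bump_tendsto_1] by (intro always_eventually allI) force
  qed
  then have lim: "((\<lambda>R. (LINT x|lebesgue. g x * bump R m x) / c) \<longlongrightarrow> (LINT x|lebesgue. g x) / c) at_top"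
    using c by (intro tendsto_intros)
  have lim0: "((\<lambda>R. K * R powr ?e) \<longlongrightarrow> K * 0) at_top"
    using e by (intro tendsto_mult tendsto_const tendsto_neg_powr filterlim_ident)
  have "\<forall>\<^sub>F R in at_top. (LINT x|lebesgue. g x * bump R m x) / c \<le> K * R powr ?e"
    using eventually_gt_at_top[of 0] by eventually_elim (rule *)
  then have "(LINT x|lebesgue. g x) / c \<le> K * 0"
    by (rule tendsto_le[OF trivial_limit_at_top_linorder lim0 lim])
  then show False using cg by (auto simp: divide_le_0_iff zero_less_mult_iff)
qed

theorem theorem1:
  fixes a \<alpha> \<gamma> p :: real and \<mu> :: complex and f :: "real ^ 'n \<Rightarrow> complex"
  assumes "a > 0" and "0 < \<alpha>" and "\<alpha> < 1" and "\<mu> \<noteq> 0"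
    and "\<gamma> > - \<alpha>" and "\<gamma> * (real CARD('n) * \<alpha> - 2) < 2 * \<alpha>"
    and "max 1 (1 + \<gamma>) < p" and "p < 1 + 2 * (\<alpha> + \<gamma>) / (real CARD('n) * \<alpha>)"
    and "integrable lebesgue f"
    and "Re \<mu> * (LINT x|lebesgue. cos (pi * \<alpha> / 2) * Re (f x) - sin (pi * \<alpha> / 2) * Im (f x)) > 0
       \<or> Im \<mu> * (LINT x|lebesgue. sin (pi * \<alpha> / 2) * Re (f x) + cos (pi * \<alpha> / 2) * Im (f x)) > 0"
  shows "\<not> (\<exists>u. global_weak_solution a \<alpha> \<mu> \<gamma> p f u)"
proof
  assume "\<exists>u. global_weak_solution a \<alpha> \<mu> \<gamma> p f u"
  then obtain u where u: "global_weak_solution a \<alpha> \<mu> \<gamma> p f u" ..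
  have loc: "L1_loc_on ({a..} \<times> UNIV) (\<lambda>(t, x). ln (t / a) powr \<gamma> * cmod (u (t, x)) powr p)"
    using u by (simp add: global_weak_solution_def)
  note weak = u[unfolded global_weak_solution_def Let_def, THEN conjunct2, THEN conjunct2, rule_format]
  have p: "p > 1" "p > 1 + \<gamma>" using assms(7) by auto
  have f: "integrable lebesgue (\<lambda>x. Re (f x))" "integrable lebesgue (\<lambda>x. Im (f x))"
    using assms(9) by auto
  \<comment> \<open>One crude bound for all four choices of \<open>U\<close> and \<open>V\<close>:
    the coefficients are 0, 1 or a signed sine or cosine.\<close>
  have comb: "\<bar>r * Re w + s * Im w\<bar> \<le> 2 * cmod w" if "\<bar>r\<bar> \<le> 1" "\<bar>s\<bar> \<le> 1" for r s and w :: complex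
  proof -
    have "\<bar>r * Re w + s * Im w\<bar> \<le> \<bar>r\<bar> * \<bar>Re w\<bar> + \<bar>s\<bar> * \<bar>Im w\<bar>"
      by (metis abs_mult abs_triangle_ineq)
    also have "\<dots> \<le> 1 * cmod w + 1 * cmod w"
      using that by (intro add_mono mult_mono abs_Re_le_cmod abs_Im_le_cmod) auto
    finally show ?thesis by simp
  qed
  from assms(10) show False
  proof
    assume pos: "Re \<mu> * (LINT x|lebesgue. cos (pi * \<alpha> / 2) * Re (f x) - sin (pi * \<alpha> / 2) * Im (f x)) > 0"
    show False
    \<comment> \<open>Each alternative of the sign condition contradicts its own equation: the real
      one here, the imaginary one in the other case.\<close>
    proof (rule no_weak_balance[OF assms(1-3) p assms(8) _ pos loc _ _ weak[THEN conjunct1]])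
      show "integrable lebesgue (\<lambda>x. cos (pi * \<alpha> / 2) * Re (f x) - sin (pi * \<alpha> / 2) * Im (f x))"
        using f by simp
      show "\<bar>Re (u z)\<bar> \<le> 2 * cmod (u z)" for z using comb[of 1 0 "u z"] by simp
      show "\<bar>cos (pi * \<alpha> / 2) * Re (u z) - sin (pi * \<alpha> / 2) * Im (u z)\<bar> \<le> 2 * cmod (u z)" for z
        using comb[of "cos (pi * \<alpha> / 2)" "- sin (pi * \<alpha> / 2)" "u z"] by simp
    qed
  next
    assume pos: "Im \<mu> * (LINT x|lebesgue. sin (pi * \<alpha> / 2) * Re (f x) + cos (pi * \<alpha> / 2) * Im (f x)) > 0"
    show False
    proof (rule no_weak_balance[OF assms(1-3) p assms(8) _ pos loc _ _ weak[THEN conjunct2]])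
      show "integrable lebesgue (\<lambda>x. sin (pi * \<alpha> / 2) * Re (f x) + cos (pi * \<alpha> / 2) * Im (f x))"
        using f by simp
      show "\<bar>Im (u z)\<bar> \<le> 2 * cmod (u z)" for z using comb[of 0 1 "u z"] by simp
      show "\<bar>sin (pi * \<alpha> / 2) * Re (u z) + cos (pi * \<alpha> / 2) * Im (u z)\<bar> \<le> 2 * cmod (u z)" for z
        by (rule comb) auto
    qed
  qed
qed

end
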